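(* Let $X$ be a real Banach space, let $k$ be a positive integer, and let $L_P, L_Q\subset X$ be two parallel affine subspaces of dimension $k$ (translates of the same $k$-dimensional linear subspace) with $0\in L_P$. Put $P=B_1(0)\cap L_P$ and $Q=B_1(0)\cap L_Q$. Then $Q$ can be covered by a translate of the set $\min\left\{\frac{2k}{k+1},\ \zeta_X\right\}P$; that is, there exists $v\in X$ such that $$Q\subset v+\min\left\{\frac{2k}{k+1},\ \zeta_X\right\}P.$$
   Context: For a real normed space $X$, $B_R(c)$ denotes the closed ball with center $c$ and radius $R>0$, $\operatorname{co} D$ is the convex hull of $D$, and $\rho(x,A)=\inf_{a\in A}\|x-a\|$. The deviation of $A$ from $B$ is $h^{+}(A,B)=\sup_{x\in A}\rho(x,B)$. The CHD-constant (convex hull deviation constant) of $X$ is $\zeta_X=\sup h^{+}(\operatorname{co} D, D)$, where the supremum is over all nonempty sets $D\subset B_1(0)$. *)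

theory Defs
  imports "HOL-Analysis.Analysis"
begin

text \<open>The supremum is taken in the reals, so this is the intended deviation only when \<open>A\<close> is
  nonempty and \<open>\<lambda>x. infdist x B\<close> is bounded on \<open>A\<close>, and \<open>B\<close> is nonempty
  (\<open>infdist x {} = 0\<close>).\<close>

definition deviation :: "'a::metric_space set \<Rightarrow> 'a set \<Rightarrow> real" where
  "deviation A B = (SUP x\<in>A. infdist x B)"

text \<open>For nonempty \<open>D \<subseteq> cball 0 1\<close> every value \<open>infdist x D\<close> with \<open>x \<in> convex hull D\<close> lies in
  \<open>{0..2}\<close>, so both suprema below are suprema of nonempty bounded sets of reals.\<close>

definition chd_constant :: "'a::real_normed_vector itself \<Rightarrow> real" where
  "chd_constant _ =
    (SUP D\<in>{D :: 'a set. D \<noteq> {} \<and> D \<subseteq> cball 0 1}. deviation (convex hull D) D)"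

end

theory Submission
  imports Defs
begin

text \<open>
  Let \<open>r\<close> be the minimum in the theorem. The point \<open>v\<close> is a common point of \<open>Q\<close> and all the balls
  \<open>cball q r\<close> with \<open>q \<in> Q\<close>. Since \<open>v\<close> and \<open>q\<close> lie in the same translate of \<open>V\<close>, the vector
  \<open>q - v\<close> lies in \<open>V\<close> and has norm at most \<open>r\<close>, hence in \<open>r P\<close>.

  To find \<open>v\<close>, note that \<open>Q\<close> is compact because \<open>V\<close> is finite-dimensional
  (\<open>compact_cball_Int_finite_span\<close>), so finitely many balls at a time suffice. For a finite
  \<open>D \<subseteq> Q\<close> the balls around the points of \<open>D\<close> meet inside \<open>convex hull D\<close> by the
  Knaster-Kuratowski-Mazurkiewicz principle (\<open>kkm_convex\<close>), provided that for every nonempty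
  \<open>E \<subseteq> D\<close> the balls around the points of \<open>E\<close> cover \<open>convex hull E\<close>. In other words, each point
  of \<open>convex hull E\<close> must be within \<open>r\<close> of a point of \<open>E\<close>. Both bounds in the minimum come from
  this condition. That the CHD-constant suffices is its definition, as \<open>E\<close> lies in the unit ball.
  That \<open>2k / (k + 1)\<close> suffices follows from Caratheodory's theorem: the point is a convex
  combination of at most \<open>k + 1\<close> points of \<open>E\<close>, one of the weights is at least \<open>1 / (k + 1)\<close>, and
  the other points are at distance at most \<open>2\<close> from the corresponding one
  (\<open>convex_hull_near_vertex\<close>).

  Balls are convex, and for convex sets the KKM principle needs no fixed point theorem. It follows
  by induction from the Berge-Klee theorem (\<open>klee_convex_union\<close>), which in turn is proved by
  cutting with a separating hyperplane.
\<close>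

section \<open>Finite-dimensional subspaces of a normed space\<close>

text \<open>This is the equivalence of the norm with the \<open>l\<^sup>1\<close> norm of the coordinates: the coefficient
  vectors of \<open>l\<^sup>1\<close> norm one form a compact set in the product topology, on which the norm of the
  combination attains a minimum, positive by independence.\<close>

lemma norm_ge_sum_abs_coefficients:
  fixes B :: "'a::real_normed_vector set"
  assumes fin: "finite B" and ind: "independent B"
  shows "\<exists>m>0. \<forall>c. m * (\<Sum>b\<in>B. \<bar>c b\<bar>) \<le> norm (\<Sum>b\<in>B. c b *\<^sub>R b)"
proof (cases "B = {}")
  case True
  then show ?thesis by (intro exI[of _ 1]) auto
next
  case False
  define K :: "('a \<Rightarrow> real) set" where "K = PiE UNIV (\<lambda>b. if b \<in> B then {-1..1} else {0})"
  define S where "S = K \<inter> {c. (\<Sum>b\<in>B. \<bar>c b\<bar>) = 1}"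
  have "compactin (product_topology (\<lambda>i. euclidean) UNIV) K"
    unfolding K_def by (subst compactin_PiE) auto
  then have "compact K"
    by (simp add: euclidean_product_topology)
  moreover have "closed {c :: 'a \<Rightarrow> real. (\<Sum>b\<in>B. \<bar>c b\<bar>) = 1}"
    by (intro closed_Collect_eq continuous_intros continuous_on_product_coordinates)
  ultimately have "compact S"
    unfolding S_def by (rule compact_Int_closed)
  obtain b0 where "b0 \<in> B" using False by auto
  then have "(\<lambda>b. if b = b0 then 1 else 0) \<in> S"
    using fin by (auto simp: S_def K_def if_distrib cong: if_cong)
  then have "S \<noteq> {}" by auto
  have "continuous_on S (\<lambda>c. norm (\<Sum>b\<in>B. c b *\<^sub>R b))"
    by (intro continuous_intros continuous_on_subset[OF continuous_on_product_coordinates]) auto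
  from continuous_attains_inf[OF \<open>compact S\<close> \<open>S \<noteq> {}\<close> this]
  obtain c0 where c0: "c0 \<in> S"
    and min: "\<And>c. c \<in> S \<Longrightarrow> norm (\<Sum>b\<in>B. c0 b *\<^sub>R b) \<le> norm (\<Sum>b\<in>B. c b *\<^sub>R b)"
    by auto
  define m where "m = norm (\<Sum>b\<in>B. c0 b *\<^sub>R b)"
  have "m \<noteq> 0"
  proof
    assume "m = 0"
    then have "(\<Sum>b\<in>B. c0 b *\<^sub>R b) = 0" by (simp add: m_def)
    then have "\<forall>b\<in>B. c0 b = 0"
      using ind fin by (metis independent_explicit_finite_subsets subset_refl)
    then show False using c0 by (simp add: S_def)
  qed
  then have "m > 0" by (simp add: m_def)
  moreover have "m * (\<Sum>b\<in>B. \<bar>c b\<bar>) \<le> norm (\<Sum>b\<in>B. c b *\<^sub>R b)" for c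
  proof (cases "(\<Sum>b\<in>B. \<bar>c b\<bar>) = 0")
    case False
    define s where "s = (\<Sum>b\<in>B. \<bar>c b\<bar>)"
    have "s \<ge> 0" "s \<noteq> 0" using False by (simp_all add: s_def sum_nonneg)
    then have "s > 0" by simp
    define c' where "c' = (\<lambda>b. if b \<in> B then c b / s else 0)"
    have "(\<Sum>b\<in>B. \<bar>c' b\<bar>) = (\<Sum>b\<in>B. \<bar>c b\<bar> / s)"
      using \<open>s > 0\<close> by (intro sum.cong) (auto simp: c'_def)
    also have "\<dots> = 1"
      using \<open>s > 0\<close> by (simp add: sum_divide_distrib[symmetric] s_def)
    finally have sum1: "(\<Sum>b\<in>B. \<bar>c' b\<bar>) = 1" .
    have "c' b \<in> {-1..1}" if "b \<in> B" for b
      using member_le_sum[of b B "\<lambda>b. \<bar>c' b\<bar>"] fin that sum1 by (simp add: abs_le_iff)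
    moreover have "c' b = 0" if "b \<notin> B" for b
      using that by (simp add: c'_def)
    ultimately have "c' \<in> S"
      using sum1 by (simp add: S_def K_def PiE_iff)
    then have "m \<le> norm (\<Sum>b\<in>B. c' b *\<^sub>R b)"
      using min by (simp add: m_def)
    also have "(\<Sum>b\<in>B. c' b *\<^sub>R b) = (1 / s) *\<^sub>R (\<Sum>b\<in>B. c b *\<^sub>R b)"
      by (simp add: scaleR_sum_right c'_def)
    finally show ?thesis
      using \<open>s > 0\<close> by (simp add: s_def[symmetric] field_simps)
  qed simp
  ultimately show ?thesis by blast
qed

lemma finite_span_basis:
  fixes A :: "'a::real_vector set"
  assumes "finite A"
  obtains B where "finite B" "independent B" "span B = span A"
proof -
  obtain B where B: "B \<subseteq> A" "independent B" "A \<subseteq> span B" "card B = dim A"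
    using basis_exists[of A] .
  have "span B = span A"
    using span_mono[OF B(1)] span_minimal[OF B(3) subspace_span] by (rule subset_antisym)
  then show ?thesis
    by (rule that[OF finite_subset[OF B(1) assms] B(2)])
qed

text \<open>Unlike \<open>representation\<close>, which vanishes outside the span, these coordinates are linear on the
  whole space.\<close>

lemma coordinate_functionals:
  fixes B :: "'a::real_vector set"
  assumes fin: "finite B" and ind: "independent B"
  obtains \<phi> :: "'a \<Rightarrow> 'a \<Rightarrow> real" where "\<And>b. linear (\<phi> b)"
    "\<And>x. x \<in> span B \<Longrightarrow> (\<Sum>b\<in>B. \<phi> b x *\<^sub>R b) = x"
proof -
  have "\<exists>f :: 'a \<Rightarrow> real. linear f \<and> (\<forall>x\<in>B. f x = (if x = b then 1 else 0))" for b
    using linear_independent_extend[OF ind] .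
  then obtain \<phi> :: "'a \<Rightarrow> 'a \<Rightarrow> real" where lin: "\<And>b. linear (\<phi> b)"
    and val: "\<And>b x. x \<in> B \<Longrightarrow> \<phi> b x = (if x = b then 1 else 0)"
    by metis
  have "(\<Sum>b\<in>B. \<phi> b x *\<^sub>R b) = x" if "x \<in> span B" for x
    using that
  proof (induction rule: span_induct_alt)
    case base
    then show ?case by (simp add: linear_0[OF lin])
  next
    case (step c z y)
    have "(\<Sum>b\<in>B. \<phi> b z *\<^sub>R b) = z"
      using step(1) fin by (simp add: val if_distrib[of "\<lambda>t. t *\<^sub>R _"] cong: if_cong)
    then show ?case
      using step(2)
      by (simp add: linear_add[OF lin] linear_cmul[OF lin] scaleR_add_left sum.distrib
          scaleR_sum_right[symmetric] flip: scaleR_scaleR)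
  qed
  then show ?thesis using that lin by blast
qed

lemma linear_continuous_on_finite_span:
  fixes f :: "'a::real_normed_vector \<Rightarrow> 'b::real_normed_vector"
  assumes "finite A" and f: "linear f"
  shows "continuous_on (span A) f"
proof -
  obtain B where B: "finite B" "independent B" "span B = span A"
    using finite_span_basis[OF \<open>finite A\<close>] .
  obtain m where m: "m > 0" "\<And>c. m * (\<Sum>b\<in>B. \<bar>c b\<bar>) \<le> norm (\<Sum>b\<in>B. c b *\<^sub>R b)"
    using norm_ge_sum_abs_coefficients[OF B(1,2)] by auto
  obtain \<phi> :: "'a \<Rightarrow> 'a \<Rightarrow> real" where
    \<phi>: "\<And>x. x \<in> span B \<Longrightarrow> (\<Sum>b\<in>B. \<phi> b x *\<^sub>R b) = x"
    using coordinate_functionals[OF B(1,2)] by metis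
  define M where "M = (\<Sum>b\<in>B. norm (f b)) / m"
  have "M \<ge> 0" using m(1) by (simp add: M_def sum_nonneg)
  have bound: "norm (f x) \<le> M * norm x" if "x \<in> span B" for x
  proof -
    have "f x = (\<Sum>b\<in>B. \<phi> b x *\<^sub>R f b)"
      by (subst \<phi>[OF that, symmetric]) (simp add: linear_sum[OF f] linear_cmul[OF f])
    then have "norm (f x) \<le> (\<Sum>b\<in>B. \<bar>\<phi> b x\<bar> * norm (f b))"
      using norm_sum[of "\<lambda>b. \<phi> b x *\<^sub>R f b" B] by simp
    also have "\<dots> \<le> (\<Sum>b\<in>B. (norm x / m) * norm (f b))"
    proof (intro sum_mono mult_right_mono)
      fix b assume "b \<in> B"
      then have "\<bar>\<phi> b x\<bar> \<le> (\<Sum>b\<in>B. \<bar>\<phi> b x\<bar>)"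
        using member_le_sum[of b B "\<lambda>b. \<bar>\<phi> b x\<bar>"] B(1) by simp
      also have "\<dots> \<le> norm x / m"
        using m(1) m(2)[of "\<lambda>b. \<phi> b x"] by (simp add: \<phi>[OF that] field_simps)
      finally show "\<bar>\<phi> b x\<bar> \<le> norm x / m" .
    qed simp
    also have "\<dots> = M * norm x"
      by (simp add: M_def sum_distrib_left[symmetric] sum_divide_distrib[symmetric] mult.commute)
    finally show ?thesis .
  qed
  have "M-lipschitz_on (span B) f"
  proof (rule lipschitz_onI)
    fix x y assume "x \<in> span B" "y \<in> span B"
    then show "dist (f x) (f y) \<le> M * dist x y"
      using bound[of "x - y"] by (simp add: dist_norm linear_diff[OF f] span_diff)
  qed (fact \<open>M \<ge> 0\<close>)
  then show ?thesis
    using lipschitz_on_continuous_on B(3) by metis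
qed

text \<open>Coefficients of vectors in the ball are bounded by \<open>norm_ge_sum_abs_coefficients\<close>, so the set is
  the part in a closed ball of a continuous image of a compact box.\<close>

lemma compact_cball_Int_finite_span:
  fixes A :: "'a::real_normed_vector set"
  assumes "finite A"
  shows "compact (cball 0 R \<inter> span A)"
proof -
  obtain B where B: "finite B" "independent B" "span B = span A"
    using finite_span_basis[OF \<open>finite A\<close>] .
  obtain m where m: "m > 0" "\<And>c. m * (\<Sum>b\<in>B. \<bar>c b\<bar>) \<le> norm (\<Sum>b\<in>B. c b *\<^sub>R b)"
    using norm_ge_sum_abs_coefficients[OF B(1,2)] by auto
  obtain \<phi> :: "'a \<Rightarrow> 'a \<Rightarrow> real" where
    \<phi>: "\<And>x. x \<in> span B \<Longrightarrow> (\<Sum>b\<in>B. \<phi> b x *\<^sub>R b) = x"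
    using coordinate_functionals[OF B(1,2)] by metis
  define K :: "('a \<Rightarrow> real) set" where "K = PiE UNIV (\<lambda>b. {-(R/m)..R/m})"
  define g where "g = (\<lambda>c. \<Sum>b\<in>B. c b *\<^sub>R b)"
  have "compactin (product_topology (\<lambda>i. euclidean) UNIV) K"
    unfolding K_def by (subst compactin_PiE) auto
  then have "compact K"
    by (simp add: euclidean_product_topology)
  moreover have "continuous_on K g"
    unfolding g_def
    by (intro continuous_intros continuous_on_subset[OF continuous_on_product_coordinates]) auto
  ultimately have "compact (g ` K)"
    by (intro compact_continuous_image)
  have "cball 0 R \<inter> span B = cball 0 R \<inter> g ` K"
  proof (intro subset_antisym subsetI)
    fix x assume x: "x \<in> cball 0 R \<inter> span B"
    have coord: "\<phi> b x \<in> {- (R / m)..R / m}" if "b \<in> B" for b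
    proof -
      have "\<bar>\<phi> b x\<bar> \<le> (\<Sum>b\<in>B. \<bar>\<phi> b x\<bar>)"
        using member_le_sum[of b B "\<lambda>b. \<bar>\<phi> b x\<bar>"] B(1) that by simp
      also have "\<dots> \<le> norm x / m"
        using m(1) m(2)[of "\<lambda>b. \<phi> b x"] \<phi>[of x] x by (simp add: field_simps)
      also have "\<dots> \<le> R / m"
        using x m(1) by (simp add: divide_right_mono)
      finally show ?thesis unfolding abs_le_iff atLeastAtMost_iff by linarith
    qed
    have "norm x \<le> R" using x by simp
    then have "R \<ge> 0" using norm_ge_zero[of x] by linarith
    then have "R / m \<ge> 0" using m(1) by simp
    define c where "c = (\<lambda>b. if b \<in> B then \<phi> b x else 0)"
    have "c \<in> K"
      unfolding K_def using coord \<open>R / m \<ge> 0\<close> by (simp add: PiE_iff c_def)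
    have "g c = (\<Sum>b\<in>B. \<phi> b x *\<^sub>R b)"
      unfolding g_def by (rule sum.cong) (simp_all add: c_def)
    then have "g c = x" using \<phi>[of x] x by simp
    then have "x \<in> g ` K" using \<open>c \<in> K\<close> by blast
    then show "x \<in> cball 0 R \<inter> g ` K" using x by simp
  next
    fix x assume x: "x \<in> cball 0 R \<inter> g ` K"
    have "g c \<in> span B" for c
      unfolding g_def by (intro span_sum span_scale span_base)
    then show "x \<in> cball 0 R \<inter> span B" using x by auto
  qed
  then show ?thesis
    unfolding B(3) by (simp only: closed_Int_compact[OF closed_cball \<open>compact (g ` K)\<close>])
qed

section \<open>Separation and intersections of convex sets\<close>

text \<open>Coordinates put an inner product on the span. Taking the inner product with the element \<open>w\<close> of
  \<open>K\<close> of least Euclidean length separates \<open>K\<close> from \<open>0\<close>.\<close>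

lemma separating_functional_0:
  fixes K :: "'a::real_normed_vector set"
  assumes "finite A" "K \<subseteq> span A" "compact K" "convex K" "0 \<notin> K"
  obtains f :: "'a \<Rightarrow> real" and \<delta> where "linear f" "\<delta> > 0" "\<And>x. x \<in> K \<Longrightarrow> f x \<ge> \<delta>"
proof (cases "K = {}")
  case True
  then show ?thesis
    using that[of "\<lambda>_. 0" 1] by (simp add: linear_zero)
next
  case False
  obtain B where B: "finite B" "independent B" "span B = span A"
    using finite_span_basis[OF \<open>finite A\<close>] .
  obtain \<phi> :: "'a \<Rightarrow> 'a \<Rightarrow> real" where lin: "\<And>b. linear (\<phi> b)"
    and \<phi>: "\<And>x. x \<in> span B \<Longrightarrow> (\<Sum>b\<in>B. \<phi> b x *\<^sub>R b) = x"
    using coordinate_functionals[OF B(1,2)] by metis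
  define ip where "ip x y = (\<Sum>b\<in>B. \<phi> b x * \<phi> b y)" for x y
  have lin_ip: "linear (ip x)" for x
    by (rule linearI) (simp_all add: ip_def linear_add[OF lin] linear_cmul[OF lin]
        distrib_left sum.distrib sum_distrib_left mult.left_commute)
  have ip_sq_nonneg: "ip x x \<ge> 0" for x
    by (simp add: ip_def sum_nonneg)
  have "continuous_on K (\<phi> b)" for b
    using linear_continuous_on_finite_span[OF \<open>finite A\<close> lin] \<open>K \<subseteq> span A\<close>
    by (rule continuous_on_subset)
  then have "continuous_on K (\<lambda>x. ip x x)"
    unfolding ip_def by (intro continuous_intros)
  from continuous_attains_inf[OF \<open>compact K\<close> False this]
  obtain w where w: "w \<in> K" and min: "\<And>x. x \<in> K \<Longrightarrow> ip w w \<le> ip x x"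
    by auto
  have "ip w w \<noteq> 0"
  proof
    assume "ip w w = 0"
    then have "\<forall>b\<in>B. \<phi> b w = 0"
      using B(1) by (simp add: ip_def sum_nonneg_eq_0_iff)
    then have "w = 0"
      using \<phi>[of w] w assms(2) B(3) by auto
    then show False using w assms(5) by simp
  qed
  then have "ip w w > 0" using ip_sq_nonneg[of w] by simp
  moreover have "ip w x \<ge> ip w w" if x: "x \<in> K" for x
  proof (rule ccontr)
    assume "\<not> ip w x \<ge> ip w w"
    define a where "a = ip w w - ip w x"
    define q where "q = ip (x - w) (x - w)"
    have "a > 0" using \<open>\<not> ip w x \<ge> ip w w\<close> by (simp add: a_def)
    have "q \<ge> 0" by (simp add: q_def ip_sq_nonneg)
    \<comment> \<open>Moving from \<open>w\<close> towards \<open>x\<close> by \<open>s\<close> changes the square by \<open>s\<^sup>2 q - 2 s a\<close>;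
      this \<open>s\<close> makes the linear term dominate.\<close>
    define s where "s = a / (a + q)"
    have s: "0 < s" "s \<le> 1" "s * q < 2 * a"
    proof -
      show "0 < s" "s \<le> 1" using \<open>a > 0\<close> \<open>q \<ge> 0\<close> by (auto simp: s_def)
      have "s * q = a * (q / (a + q))" by (simp add: s_def)
      also have "\<dots> \<le> a * 1"
        using \<open>a > 0\<close> \<open>q \<ge> 0\<close> by (intro mult_left_mono) auto
      finally show "s * q < 2 * a" using \<open>a > 0\<close> by simp
    qed
    have "w + s *\<^sub>R (x - w) = (1 - s) *\<^sub>R w + s *\<^sub>R x"
      by (simp add: algebra_simps)
    then have "w + s *\<^sub>R (x - w) \<in> K"
      using convexD[OF \<open>convex K\<close> w x, of "1 - s" s] s by simp
    from min[OF this] have "ip w w \<le> ip (w + s *\<^sub>R (x - w)) (w + s *\<^sub>R (x - w))" .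
    also have "\<dots> = ip w w + s * (s * q - 2 * a)"
      unfolding ip_def q_def a_def
      by (simp add: linear_add[OF lin] linear_cmul[OF lin] linear_diff[OF lin] algebra_simps
          sum.distrib sum_subtractf sum_distrib_left)
    finally have "0 \<le> s * (s * q - 2 * a)" by simp
    then show False using s by (simp add: zero_le_mult_iff)
  qed
  ultimately show ?thesis
    using that[OF lin_ip[of w]] by blast
qed

text \<open>A functional that is bounded below by a positive number on the difference set of \<open>C\<close> and \<open>G\<close>
  separates \<open>C\<close> from \<open>G\<close>.\<close>

lemma strict_separation_finite_span:
  fixes C G :: "'a::real_normed_vector set"
  assumes "finite A" "C \<subseteq> span A" "G \<subseteq> span A" "compact C" "compact G" "convex C" "convex G"
    and "C \<inter> G = {}" "C \<noteq> {}"
  obtains f :: "'a \<Rightarrow> real" and t where "linear f" "\<And>x. x \<in> C \<Longrightarrow> f x > t" "\<And>x. x \<in> G \<Longrightarrow> f x < t"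
proof -
  define K where "K = {x - y | x y. x \<in> C \<and> y \<in> G}"
  have "K \<subseteq> span A" using assms(2,3) by (auto simp: K_def intro!: span_diff)
  moreover have "compact K"
    unfolding K_def using assms by (intro compact_differences)
  moreover have "K = (\<Union>x\<in>C. \<Union>y\<in>G. {x - y})" by (auto simp: K_def)
  then have "convex K"
    using convex_differences[OF assms(6,7)] by simp
  moreover have "0 \<notin> K" using assms(8) by (auto simp: K_def)
  ultimately obtain f :: "'a \<Rightarrow> real" and \<delta> where f: "linear f" "\<delta> > 0"
    and le: "\<And>x. x \<in> K \<Longrightarrow> f x \<ge> \<delta>"
    using separating_functional_0[OF \<open>finite A\<close>] by metis
  have "continuous_on C f"
    using linear_continuous_on_finite_span[OF \<open>finite A\<close> f(1)] assms(2)
    by (rule continuous_on_subset)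
  from continuous_attains_inf[OF \<open>compact C\<close> \<open>C \<noteq> {}\<close> this]
  obtain c where c: "c \<in> C" "\<And>x. x \<in> C \<Longrightarrow> f c \<le> f x" by auto
  show ?thesis
  proof (rule that[of f "f c - \<delta> / 2"])
    show "f x > f c - \<delta> / 2" if "x \<in> C" for x
      using c(2)[OF that] f(2) by simp
    show "f x < f c - \<delta> / 2" if "x \<in> G" for x
    proof -
      have "c - x \<in> K" using that c(1) by (auto simp: K_def)
      from le[OF this] show ?thesis using f(2) by (simp add: linear_diff[OF f(1)])
    qed
  qed (fact f(1))
qed

text \<open>The Berge-Klee theorem: if compact convex sets have a convex union and any all-but-one of them
  have a common point, then they all do. If \<open>G n\<close> missed the intersection \<open>C\<close> of the others, a
  hyperplane \<open>H\<close> would separate the two. The traces of the other sets on \<open>H\<close> again satisfy the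
  hypotheses: their union is the trace of the whole union, as \<open>G n\<close> misses \<open>H\<close>, and a segment
  from \<open>G n\<close> to \<open>C\<close> supplies common points. By induction these traces have a common point, which
  is a point of \<open>C\<close> on \<open>H\<close>, a contradiction.

  Common points are taken in the union so that the base case, a single set, asserts that this set
  is nonempty.\<close>

lemma klee_convex_union:
  fixes G :: "'i \<Rightarrow> 'a::real_normed_vector set"
  assumes "finite I" "I \<noteq> {}" "finite A"
    and "\<And>i. i \<in> I \<Longrightarrow> compact (G i)" "\<And>i. i \<in> I \<Longrightarrow> convex (G i)"
    and "\<And>i. i \<in> I \<Longrightarrow> G i \<subseteq> span A"
    and "convex (\<Union>i\<in>I. G i)"
    and "\<And>i. i \<in> I \<Longrightarrow> \<exists>y\<in>(\<Union>i\<in>I. G i). \<forall>j\<in>I - {i}. y \<in> G j"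
  shows "(\<Inter>i\<in>I. G i) \<noteq> {}"
  using assms
proof (induction arbitrary: G rule: finite_ne_induct)
  case (singleton i)
  show ?case using singleton.prems(6)[of i] by auto
next
  case (insert n I)
  define U where "U = (\<Union>i\<in>insert n I. G i)"
  define C where "C = (\<Inter>i\<in>I. G i)"
  have U: "convex U" using insert.prems(5) by (simp add: U_def)
  have y: "\<exists>y\<in>U. \<forall>j\<in>insert n I - {i}. y \<in> G j" if "i \<in> insert n I" for i
    using insert.prems(6)[OF that] by (simp add: U_def)
  have "insert n I - {n} = I" using insert.hyps(3) by simp
  then obtain yn where yn: "yn \<in> U" "yn \<in> C"
    using y[of n] unfolding C_def by blast
  have C_sub: "C \<subseteq> G i" if "i \<in> I" for i using that by (auto simp: C_def)
  show ?case
  proof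
    assume empty: "(\<Inter>i\<in>insert n I. G i) = {}"
    have compI: "compact (G i)" and convI: "convex (G i)" and spanI: "G i \<subseteq> span A"
      if "i \<in> insert n I" for i using insert.prems that by auto
    obtain i0 where "i0 \<in> I" using insert.hyps(2) by auto
    have "closed C"
      unfolding C_def using compI by (auto intro: compact_imp_closed)
    then have "compact (G i0 \<inter> C)"
      using compI \<open>i0 \<in> I\<close> by (intro compact_Int_closed) auto
    then have "compact C"
      using C_sub[OF \<open>i0 \<in> I\<close>] by (simp add: Int_absorb1)
    have "convex C" unfolding C_def using convI by (auto intro: convex_INT)
    have "C \<subseteq> span A" using C_sub[OF \<open>i0 \<in> I\<close>] spanI \<open>i0 \<in> I\<close> by blast
    have "C \<inter> G n = {}" using empty by (auto simp: C_def)
    obtain f :: "'a \<Rightarrow> real" and t where f: "linear f"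
      and above: "\<And>x. x \<in> C \<Longrightarrow> f x > t" and below: "\<And>x. x \<in> G n \<Longrightarrow> f x < t"
      using strict_separation_finite_span[OF \<open>finite A\<close> \<open>C \<subseteq> span A\<close> spanI \<open>compact C\<close> compI
          \<open>convex C\<close> convI \<open>C \<inter> G n = {}\<close>] yn(2) by blast
    define H where "H = span A \<inter> {x. f x = t}"
    have "convex {x. f x = t}"
      by (auto simp: convex_def linear_add[OF f] linear_cmul[OF f] distrib_right[symmetric])
    have U_H: "(\<Union>i\<in>I. G i \<inter> H) = U \<inter> {x. f x = t}"
      using below spanI by (fastforce simp: U_def H_def)
    have "(\<Inter>i\<in>I. G i \<inter> H) \<noteq> {}"
    proof (rule insert.IH)
      fix i assume i: "i \<in> I"
      have "continuous_on (G i) f"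
        using linear_continuous_on_finite_span[OF \<open>finite A\<close> f] spanI i
        by (blast intro: continuous_on_subset)
      then have "closed (G i \<inter> f -` {t})"
        using compI i by (intro continuous_closed_preimage) (auto intro: compact_imp_closed)
      then have "compact (G i \<inter> (G i \<inter> f -` {t}))"
        using compI i by (intro compact_Int_closed) auto
      moreover have GH: "G i \<inter> H = G i \<inter> (G i \<inter> f -` {t})"
        using spanI i by (auto simp: H_def)
      ultimately show "compact (G i \<inter> H)" by simp
      have "G i \<inter> H = G i \<inter> {x. f x = t}" using GH by auto
      then show "convex (G i \<inter> H)"
        using convI i \<open>convex {x. f x = t}\<close> by (simp add: convex_Int)
      show "G i \<inter> H \<subseteq> span A" by (auto simp: H_def)
      obtain yi where yi: "yi \<in> U" "\<forall>j\<in>insert n I - {i}. yi \<in> G j"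
        using y[of i] i by auto
      have "f yi < t" using below yi(2) i insert.hyps(3) by auto
      have "f yn > t" using above yn(2) by auto
      \<comment> \<open>The segment from \<open>yi\<close>, below the hyperplane, to \<open>yn\<close>, above it, crosses it at \<open>z\<close>.\<close>
      define s where "s = (t - f yi) / (f yn - f yi)"
      define z where "z = (1 - s) *\<^sub>R yi + s *\<^sub>R yn"
      have s: "0 \<le> s" "s \<le> 1"
        using \<open>f yi < t\<close> \<open>f yn > t\<close> by (auto simp: s_def field_simps)
      have "f z = f yi + s * (f yn - f yi)"
        unfolding z_def linear_add[OF f] linear_cmul[OF f] by (simp add: algebra_simps)
      also have "\<dots> = t" using \<open>f yi < t\<close> \<open>f yn > t\<close> by (simp add: s_def)
      finally have "f z = t" .
      have "z \<in> U" unfolding z_def using s U yi(1) yn(1) by (intro convexD) auto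
      have zG: "z \<in> G j" if "j \<in> I - {i}" for j
        unfolding z_def using s that convI yi(2) C_sub[of j] yn(2)
        by (intro convexD) auto
      have "z \<in> span A" using \<open>z \<in> U\<close> spanI by (auto simp: U_def)
      then show "\<exists>y\<in>(\<Union>i\<in>I. G i \<inter> H). \<forall>j\<in>I - {i}. y \<in> G j \<inter> H"
        using \<open>z \<in> U\<close> \<open>f z = t\<close> zG unfolding U_H by (auto simp: H_def)
    next
      show "convex (\<Union>i\<in>I. G i \<inter> H)"
        unfolding U_H using U \<open>convex {x. f x = t}\<close> by (rule convex_Int)
    qed (fact \<open>finite A\<close>)
    then obtain x where "\<forall>i\<in>I. x \<in> G i \<inter> H" by blast
    then have "x \<in> C" "f x = t" using \<open>i0 \<in> I\<close> by (auto simp: C_def H_def)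
    then show False using above by force
  qed
qed

text \<open>The KKM principle for convex sets. The traces of the sets on \<open>convex hull D\<close> have a convex
  union, namely the hull itself, and the induction hypothesis for \<open>D - {d}\<close> gives a common point
  of all of them except that of \<open>d\<close>, so the Berge-Klee theorem applies.\<close>

lemma kkm_convex:
  fixes G :: "'a::real_normed_vector \<Rightarrow> 'a set"
  assumes "finite D" "D \<noteq> {}"
    and "\<And>d. d \<in> D \<Longrightarrow> closed (G d)" "\<And>d. d \<in> D \<Longrightarrow> convex (G d)"
    and "\<And>E. E \<subseteq> D \<Longrightarrow> E \<noteq> {} \<Longrightarrow> convex hull E \<subseteq> (\<Union>e\<in>E. G e)"
  shows "convex hull D \<inter> (\<Inter>d\<in>D. G d) \<noteq> {}"
  using assms
proof (induction rule: finite_psubset_induct)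
  case (psubset D)
  let ?F = "\<lambda>d. G d \<inter> convex hull D"
  have union: "(\<Union>d\<in>D. ?F d) = convex hull D"
    using psubset.prems(4)[of D] psubset.prems(1) by blast
  have "(\<Inter>d\<in>D. ?F d) \<noteq> {}"
  proof (rule klee_convex_union[where A = D])
    show "finite D" "D \<noteq> {}" "finite D" by (fact psubset)+
    show "convex (\<Union>d\<in>D. ?F d)" by (simp only: union convex_convex_hull)
  next
    fix d assume d: "d \<in> D"
    show "compact (?F d)"
      using psubset.prems(2)[OF d] finite_imp_compact_convex_hull[OF \<open>finite D\<close>]
      by (rule closed_Int_compact)
    show "convex (?F d)"
      using psubset.prems(3)[OF d] by (simp add: convex_Int)
    show "?F d \<subseteq> span D"
      using convex_hull_subset_span[of D] by auto
    show "\<exists>y\<in>(\<Union>d\<in>D. ?F d). \<forall>j\<in>D - {d}. y \<in> ?F j"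
    proof (cases "D - {d} = {}")
      case True
      then show ?thesis unfolding union using hull_inc[OF d] by (metis empty_iff)
    next
      case False
      have "convex hull (D - {d}) \<inter> (\<Inter>e\<in>D - {d}. G e) \<noteq> {}"
        using d False psubset.prems by (intro psubset.IH) auto
      then show ?thesis
        unfolding union using hull_mono[of "D - {d}" D convex] by blast
    qed
  qed
  then show ?case using psubset.prems(1) by auto
qed

section \<open>Distance from a convex hull to its vertices\<close>

text \<open>Caratheodory's theorem in an arbitrary real vector space. Adding to the weights of \<open>x\<close> the
  right multiple of an affine dependence makes one weight vanish while the others stay
  nonnegative, so a point of \<open>E\<close> can be dropped.\<close>

lemma convex_hull_affine_independent_subset:
  fixes E :: "'a::real_vector set"
  assumes "finite E" "x \<in> convex hull E"
  obtains S where "S \<subseteq> E" "\<not> affine_dependent S" "x \<in> convex hull S"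
proof -
  have "\<exists>S\<subseteq>E. \<not> affine_dependent S \<and> x \<in> convex hull S"
    using assms
  proof (induction rule: finite_psubset_induct)
    case (psubset E)
    show ?case
    proof (cases "affine_dependent E")
      case True
      obtain u where u: "\<And>e. e \<in> E \<Longrightarrow> 0 \<le> u e" "sum u E = 1" "(\<Sum>e\<in>E. u e *\<^sub>R e) = x"
        using psubset.prems by (auto simp: convex_hull_finite[OF \<open>finite E\<close>])
      obtain w v where w: "sum w E = 0" "v \<in> E" "w v \<noteq> 0" "(\<Sum>e\<in>E. w e *\<^sub>R e) = 0"
        using True affine_dependent_explicit_finite[OF \<open>finite E\<close>] by auto
      define N where "N = {e\<in>E. w e < 0}"
      have "N \<noteq> {}"
      proof
        assume "N = {}"
        then have "\<forall>e\<in>E. 0 \<le> w e" by (auto simp: N_def not_less)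
        then show False
          using w \<open>finite E\<close> by (simp add: sum_nonneg_eq_0_iff)
      qed
      moreover have "finite N" using \<open>finite E\<close> by (simp add: N_def)
      \<comment> \<open>The first weight to vanish as the multiple of \<open>w\<close> grows from zero.\<close>
      ultimately obtain a where a: "a \<in> N" "\<And>e. e \<in> N \<Longrightarrow> u a / - w a \<le> u e / - w e"
        using arg_min_if_finite[of N "\<lambda>e. u e / - w e"]
        by (metis not_le_imp_less)
      define t where "t = u a / - w a"
      have "a \<in> E" "w a < 0" using a(1) by (auto simp: N_def)
      have "t \<ge> 0" using u(1)[OF \<open>a \<in> E\<close>] \<open>w a < 0\<close> by (simp add: t_def divide_nonneg_neg)
      define u' where "u' e = u e + t * w e" for e
      have "u' a = 0" using \<open>w a < 0\<close> by (simp add: u'_def t_def)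
      have nonneg: "u' e \<ge> 0" if "e \<in> E" for e
      proof (cases "w e < 0")
        case True
        then have "t \<le> u e / - w e" using a(2)[of e] that by (simp add: N_def t_def)
        then show ?thesis using True by (simp add: u'_def field_simps)
      next
        case False
        then show ?thesis using u(1)[OF that] \<open>t \<ge> 0\<close> by (simp add: u'_def)
      qed
      have "sum u' E = 1"
        using u(2) w(1) by (simp add: u'_def sum.distrib sum_distrib_left[symmetric])
      then have "sum u' (E - {a}) = 1"
        using \<open>u' a = 0\<close> \<open>a \<in> E\<close> \<open>finite E\<close> by (simp add: sum.remove)
      moreover have "(\<Sum>e\<in>E. u' e *\<^sub>R e) = x"
        using u(3) w(4)
        by (simp add: u'_def scaleR_add_left sum.distrib scaleR_sum_right[symmetric]
            flip: scaleR_scaleR)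
      then have "(\<Sum>e\<in>E - {a}. u' e *\<^sub>R e) = x"
        using \<open>u' a = 0\<close> \<open>a \<in> E\<close> \<open>finite E\<close> by (simp add: sum.remove)
      ultimately have "x \<in> convex hull (E - {a})"
        using nonneg \<open>finite E\<close> by (subst convex_hull_finite) auto
      then show ?thesis
        using psubset.IH[of "E - {a}"] \<open>a \<in> E\<close> by blast
    next
      case False
      then show ?thesis using psubset.prems by blast
    qed
  qed
  then show ?thesis using that by blast
qed

lemma affine_independent_card_le:
  fixes V :: "'a::real_vector set"
  assumes "finite B" "S \<subseteq> (+) b ` span B" "\<not> affine_dependent S"
  shows "finite S \<and> card S \<le> card B + 1"
proof (cases "S = {}")
  case False
  then obtain a where a: "a \<in> S" by auto
  let ?T = "(\<lambda>x. - a + x) ` (S - {a})"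
  have "independent ?T"
    using affine_dependent_iff_dependent2[OF a] assms(3) by simp
  moreover have "?T \<subseteq> span B"
  proof
    fix y assume "y \<in> ?T"
    then obtain x where x: "x \<in> S" "y = - a + x" by auto
    obtain p q where "a = b + p" "x = b + q" "p \<in> span B" "q \<in> span B"
      using assms(2) a x(1) by blast
    then show "y \<in> span B" using x(2) span_diff[of q B p] by simp
  qed
  ultimately have "finite ?T \<and> card ?T \<le> card B"
    by (rule independent_span_bound[OF \<open>finite B\<close>])
  then have "finite (S - {a}) \<and> card (S - {a}) \<le> card B"
    by (simp add: finite_image_iff card_image)
  then show ?thesis using a by (auto simp: card_Diff_singleton)
qed simp

text \<open>In a Caratheodory representation of \<open>x\<close> some point \<open>e\<close> has weight at least
  \<open>1 / (card B + 1)\<close>. The vector \<open>x - e\<close> is the weighted sum of the \<open>s - e\<close> over the remaining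
  points \<open>s\<close>, whose total weight is at most \<open>card B / (card B + 1)\<close>.\<close>

lemma convex_hull_near_vertex:
  fixes E :: "'a::real_normed_vector set"
  assumes "finite B" "finite E" "E \<subseteq> (+) b ` span B" "x \<in> convex hull E"
    and diam: "\<And>p q. p \<in> E \<Longrightarrow> q \<in> E \<Longrightarrow> dist p q \<le> \<delta>" 
  obtains e where "e \<in> E" "dist x e \<le> \<delta> * real (card B) / (real (card B) + 1)"
proof -
  obtain S where S: "S \<subseteq> E" "\<not> affine_dependent S" "x \<in> convex hull S"
    using convex_hull_affine_independent_subset[OF assms(2,4)] .
  have "S \<subseteq> (+) b ` span B" using S(1) assms(3) by blast
  with affine_independent_card_le[OF \<open>finite B\<close> _ S(2)]
  have "finite S" and card: "card S \<le> card B + 1" by auto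
  obtain u where u: "\<And>s. s \<in> S \<Longrightarrow> 0 \<le> u s" "sum u S = 1" "(\<Sum>s\<in>S. u s *\<^sub>R s) = x"
    using S(3) by (auto simp: convex_hull_finite[OF \<open>finite S\<close>])
  obtain e where e: "e \<in> S" "u e \<ge> 1 / (card B + 1)"
  proof (rule ccontr)
    assume "\<not> thesis"
    then have less: "\<And>s. s \<in> S \<Longrightarrow> u s < 1 / (card B + 1)"
      using that by force
    have "S \<noteq> {}" using u(2) by auto
    have "sum u S < (\<Sum>s\<in>S. 1 / (card B + 1))"
      using less \<open>finite S\<close> \<open>S \<noteq> {}\<close> by (intro sum_strict_mono) auto
    also have "\<dots> \<le> 1" using card by simp
    finally show False using u(2) by simp
  qed
  have "e \<in> E" using e S by auto
  then have "\<delta> \<ge> 0" using diam[of e e] by simp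
  have "x - e = (\<Sum>s\<in>S. u s *\<^sub>R (s - e))"
    by (simp add: scaleR_diff_right sum_subtractf u scaleR_sum_left[symmetric])
  also have "\<dots> = (\<Sum>s\<in>S - {e}. u s *\<^sub>R (s - e))"
    using e(1) \<open>finite S\<close> by (simp add: sum.remove)
  finally have "dist x e \<le> (\<Sum>s\<in>S - {e}. norm (u s *\<^sub>R (s - e)))"
    unfolding dist_norm by (simp only: norm_sum)
  also have "\<dots> \<le> (\<Sum>s\<in>S - {e}. u s * \<delta>)"
    using diam S(1) e(1) u(1)
    by (intro sum_mono) (auto simp: dist_norm[symmetric] intro!: mult_left_mono)
  also have "\<dots> = (1 - u e) * \<delta>"
    using e(1) \<open>finite S\<close> u(2) by (simp add: sum_distrib_right[symmetric] sum_diff1)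
  also have "\<dots> \<le> (1 - 1 / (card B + 1)) * \<delta>"
    using e(2) \<open>\<delta> \<ge> 0\<close> by (intro mult_right_mono) auto
  also have "\<dots> = \<delta> * real (card B) / (real (card B) + 1)"
    by (simp add: field_simps)
  finally show ?thesis using that \<open>e \<in> E\<close> by blast
qed

text \<open>Suprema of reals bound their members only over bounded sets; here everything is at most \<open>2\<close>,
  because the hull stays in the unit ball.\<close>

lemma infdist_convex_hull_le_chd_constant:
  fixes D :: "'a::real_normed_vector set"
  assumes "D \<noteq> {}" "D \<subseteq> cball 0 1" "x \<in> convex hull D"
  shows "infdist x D \<le> chd_constant TYPE('a)"
proof -
  have le2: "infdist x D \<le> 2" if D: "D \<noteq> {}" "D \<subseteq> cball 0 1" and x: "x \<in> convex hull D"
    for D :: "'a set" and x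
  proof -
    obtain d where "d \<in> D" using D by auto
    have "convex hull D \<subseteq> cball 0 1"
      using D by (intro hull_minimal) auto
    then have "norm x \<le> 1" "norm d \<le> 1" using x D \<open>d \<in> D\<close> by auto
    then have "dist x d \<le> 2"
      using norm_triangle_ineq4[of x d] by (simp add: dist_norm)
    then show ?thesis using infdist_le2[OF \<open>d \<in> D\<close>] by blast
  qed
  have bdd: "bdd_above ((\<lambda>x. infdist x D) ` (convex hull D))" if "D \<noteq> {}" "D \<subseteq> cball 0 1"
    for D :: "'a set"
    using le2[OF that] by (intro bdd_aboveI[of _ 2]) auto
  have "infdist x D \<le> deviation (convex hull D) D"
    unfolding deviation_def using bdd[OF assms(1,2)] assms(3) by (rule cSUP_upper2) simp
  also have "\<dots> \<le> chd_constant TYPE('a)"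
    unfolding chd_constant_def
  proof (rule cSUP_upper)
    show "D \<in> {D. D \<noteq> {} \<and> D \<subseteq> cball 0 1}" using assms by simp
    show "bdd_above ((\<lambda>D. deviation (convex hull D) D) ` {D :: 'a set. D \<noteq> {} \<and> D \<subseteq> cball 0 1})"
      unfolding deviation_def using le2
      by (intro bdd_aboveI[of _ 2]) (auto intro!: cSUP_least)
  qed
  finally show ?thesis .
qed

lemma infdist_finite_attained:
  assumes "finite E" "E \<noteq> {}"
  obtains e where "e \<in> E" "infdist x E = dist x e"
proof -
  have "infdist x E = Min (dist x ` E)"
    using assms by (simp add: infdist_def cInf_eq_Min)
  moreover have "Min (dist x ` E) \<in> dist x ` E"
    using assms by (intro Min_in) auto
  ultimately show ?thesis using that by auto
qed

section \<open>Covering a section of the unit ball\<close>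

theorem corollary1:
  fixes V L\<^sub>P L\<^sub>Q P Q :: "'a::banach set" and a b :: 'a and k :: nat
  assumes "k \<ge> 1"
    and "subspace V" and "dim V = k"
    and "L\<^sub>P = (+) a ` V" and "L\<^sub>Q = (+) b ` V"
    and "0 \<in> L\<^sub>P"
    and "P = cball 0 1 \<inter> L\<^sub>P"
    and "Q = cball 0 1 \<inter> L\<^sub>Q"
  shows "\<exists>v. Q \<subseteq>
    (+) v ` ((*\<^sub>R) (min (2 * real k / (real k + 1)) (chd_constant TYPE('a))) ` P)"
proof -
  define r where "r = min (2 * real k / (real k + 1)) (chd_constant TYPE('a))"
  obtain B where B: "B \<subseteq> V" "independent B" "V \<subseteq> span B" "card B = dim V"
    using basis_exists[of V] .
  have "finite B" using B(4) assms(1,3) by (auto intro: card_ge_0_finite)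
  have V: "V = span B" using B(1,3) \<open>subspace V\<close> by (metis span_subspace)
  have LP: "L\<^sub>P = V"
  proof -
    obtain p where p: "p \<in> V" "0 = a + p" using assms(4,6) by auto
    then have "a \<in> V" using subspace_neg[OF \<open>subspace V\<close>] by (metis minus_unique add.commute)
    show ?thesis
    proof (intro subset_antisym subsetI)
      show "x \<in> V" if "x \<in> L\<^sub>P" for x
        using that assms(4) \<open>a \<in> V\<close> subspace_add[OF \<open>subspace V\<close>] by auto
      show "x \<in> L\<^sub>P" if "x \<in> V" for x
        using subspace_diff[OF \<open>subspace V\<close> that \<open>a \<in> V\<close>] assms(4) by force
    qed
  qed
  have common: "convex hull D \<inter> (\<Inter>d\<in>D. cball d r) \<noteq> {}"
    if D: "finite D" "D \<noteq> {}" "D \<subseteq> Q" for D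
  proof (rule kkm_convex)
    fix E assume E: "E \<subseteq> D" "E \<noteq> {}"
    have "finite E" "E \<subseteq> cball 0 1" "E \<subseteq> (+) b ` span B"
      using E D assms(5,8) V by (auto intro: finite_subset)
    show "convex hull E \<subseteq> (\<Union>e\<in>E. cball e r)"
    proof
      fix x assume x: "x \<in> convex hull E"
      obtain e where e: "e \<in> E" "infdist x E = dist x e"
        using infdist_finite_attained[OF \<open>finite E\<close> E(2)] .
      have "infdist x E \<le> chd_constant TYPE('a)"
        using E(2) \<open>E \<subseteq> cball 0 1\<close> x by (rule infdist_convex_hull_le_chd_constant)
      moreover have "dist p q \<le> 2" if "p \<in> E" "q \<in> E" for p q
      proof -
        have "norm p \<le> 1" "norm q \<le> 1" using that \<open>E \<subseteq> cball 0 1\<close> by auto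
        then show ?thesis using norm_triangle_ineq4[of p q] by (simp add: dist_norm)
      qed
      then obtain e' where "e' \<in> E" "dist x e' \<le> 2 * real (card B) / (real (card B) + 1)"
        using convex_hull_near_vertex[OF \<open>finite B\<close> \<open>finite E\<close> \<open>E \<subseteq> (+) b ` span B\<close> x, of 2]
        by blast
      then have "infdist x E \<le> 2 * real k / (real k + 1)"
        using infdist_le2[of e' E x] B(4) assms(3) by (simp add: add.commute)
      ultimately have "dist x e \<le> r" using e(2) by (simp add: r_def)
      then show "x \<in> (\<Union>e\<in>E. cball e r)" using e(1) by (auto simp: dist_commute)
    qed
  qed (use D in auto)
  show ?thesis
  proof (cases "Q = {}")
    case False
    have "Q = cball 0 1 \<inter> (+) b ` (cball 0 (1 + norm b) \<inter> span B)"
    proof -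
      have "norm p \<le> 1 + norm b" if "norm (b + p) \<le> 1" for p
        using that norm_triangle_ineq4[of "b + p" b] by simp
      then show ?thesis using assms(5,8) V by auto
    qed
    then have "compact Q"
      using compact_translation[OF compact_cball_Int_finite_span[OF \<open>finite B\<close>]]
      by (metis closed_Int_compact closed_cball)
    have "convex L\<^sub>Q"
      using assms(5) subspace_imp_convex[OF \<open>subspace V\<close>] convex_translation by auto
    then have "convex Q" using assms(8) by (simp add: convex_Int)
    have "Q \<inter> (\<Inter>q\<in>Q. cball q r) \<noteq> {}"
    proof (rule compact_imp_fip_image[OF \<open>compact Q\<close>])
      fix D assume D: "finite D" "D \<subseteq> Q"
      show "Q \<inter> (\<Inter>q\<in>D. cball q r) \<noteq> {}"
      proof (cases "D = {}")
        case False
        then show ?thesis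
          using common[OF D(1) False D(2)] hull_minimal[of D Q convex, OF D(2) \<open>convex Q\<close>] by blast
      qed (use \<open>Q \<noteq> {}\<close> in auto)
    qed auto
    then obtain v where "v \<in> Q" "\<forall>q\<in>Q. v \<in> cball q r" by blast
    then have v: "v \<in> Q" "\<And>q. q \<in> Q \<Longrightarrow> norm (q - v) \<le> r"
      by (simp_all add: dist_norm)
    have "r \<ge> 0" using v(2)[OF v(1)] by simp
    have "Q \<subseteq> (+) v ` ((*\<^sub>R) r ` P)"
    proof
      fix q assume q: "q \<in> Q"
      obtain p p' where "q = b + p" "v = b + p'" "p \<in> V" "p' \<in> V"
        using q v(1) assms(5,8) by auto
      then have "q - v \<in> V" using subspace_diff[OF \<open>subspace V\<close>] by auto
      \<comment> \<open>For \<open>r = 0\<close> the quotient is the zero vector and \<open>q = v\<close>.\<close>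
      have "(1 / r) *\<^sub>R (q - v) \<in> P"
        using \<open>q - v \<in> V\<close> subspace_scale[OF \<open>subspace V\<close>] v(2)[OF q] \<open>r \<ge> 0\<close>
        by (auto simp: assms(7) LP divide_le_eq)
      moreover have "q = v + r *\<^sub>R ((1 / r) *\<^sub>R (q - v))"
        using v(2)[OF q] by (cases "r = 0") auto
      ultimately show "q \<in> (+) v ` ((*\<^sub>R) r ` P)" by blast
    qed
    then show ?thesis unfolding r_def by blast
  qed simp
qed

end
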